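(* Let $p,n\ge1$. For every $t\ge0$ let $0<m_t\le L_t$, $\sigma_t\ge0$, $\alpha_t\ge0$, and $f_t=\frac1n\sum_{i=1}^nf_t^{(i)}$ with differentiable $f_t^{(i)}:\mathbb R^p\to\mathbb R$. Consider the iteration $x_{t+1}=x_t-\alpha_t\nabla f_t^{(i_t)}(x_t)$ with deterministic $x_0$, where the indices $i_t$ are sampled IID uniformly from $\{1,\ldots,n\}$. For all $t$ assume: (i) $f_t$ is $m_t$-strongly convex with global minimizer $x_t^*$; (ii) $\|x_{t+1}^*-x_t^*\|\le\sigma_t$. Let $G_t\ge0$ be defined by $G_t^2=\frac1n\sum_{i=1}^n\|\nabla f_t^{(i)}(x_t^* )\|^2$. Assume one of the following holds for all $i$ and $t$, and define $\tilde X_t\in\mathbb R^{2\times2}$ accordingly: (a) $f_t^{(i)}$ is $L_t$-smooth: $\tilde X_t=\begin{bmatrix}2L_t^2&0\\0&-1\end{bmatrix}$; (b) $f_t^{(i)}$ is $L_t$-smooth and convex: $\tilde X_t=\begin{bmatrix}0&L_t\\L_t&-1\end{bmatrix}$; (c) $f_t^{(i)}$ is $L_t$-smooth and $m_t$-strongly convex: $\tilde X_t=\begin{bmatrix}-2L_tm_t&L_t+m_t\\L_t+m_t&-1\end{bmatrix}$. If there exist non-negative scalars $(\rho_t,\lambda_t^{(1)},\lambda_t^{(2)},\lambda_t^{(3)})$ such that $$\begin{bmatrix}1-\rho_t^2&-\alpha_t&1\\-\alpha_t&\alpha_t^2&-\alpha_t\\1&-\alpha_t&1-\lambda_t^{(2)}\end{bmatrix}+\lambda_t^{(1)}\begin{bmatrix}-2m_t&1&0\\1&0&0\\0&0&0\end{bmatrix}+\lambda_t^{(3)}\begin{bmatrix}\tilde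 X_t&0_{2\times1}\\0_{1\times2}&0\end{bmatrix}\preceq0,$$ then $\mathbb E\|x_{t+1}-x_{t+1}^*\|^2\le\rho_t^2\,\mathbb E\|x_t-x_t^*\|^2+\lambda_t^{(2)}\sigma_t^2+2\lambda_t^{(3)}G_t^2$.
   Context: A differentiable $f$ is $L$-smooth if $\|\nabla f(x)-\nabla f(y)\|\le L\|x-y\|$ for all $x,y$, and $m$-strongly convex if $f(x)\ge f(y)+\nabla f(y)^T(x-y)+\frac m2\|x-y\|^2$ for all $x,y$. The functions $f_t^{(i)}$ are deterministic. $P\preceq0$ means the symmetric matrix $P$ is negative semidefinite; norms are Euclidean. *)

theory Defs
  imports "HOL-Probability.Probability"
begin

text \<open>Meaningful only where \<open>f\<close> is differentiable; elsewhere the value is unspecified.\<close>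

definition grad :: "('a::real_inner \<Rightarrow> real) \<Rightarrow> 'a \<Rightarrow> 'a" where
  "grad f x = (THE g. GDERIV f x :> g)"

definition smooth_fun :: "real \<Rightarrow> ('a::real_inner \<Rightarrow> real) \<Rightarrow> bool" where
  "smooth_fun L f \<longleftrightarrow> (\<forall>x. f differentiable (at x)) \<and>
     (\<forall>x y. norm (grad f x - grad f y) \<le> L * norm (x - y))"

definition strongly_convex :: "real \<Rightarrow> ('a::real_inner \<Rightarrow> real) \<Rightarrow> bool" where
  "strongly_convex m f \<longleftrightarrow> (\<forall>x. f differentiable (at x)) \<and>
     (\<forall>x y. f x \<ge> f y + grad f y \<bullet> (x - y) + m / 2 * (norm (x - y))\<^sup>2)"

definition neg_semidef :: "real ^ 'k ^ 'k \<Rightarrow> bool" where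
  "neg_semidef P \<longleftrightarrow> transpose P = P \<and> (\<forall>v. v \<bullet> (P *v v) \<le> 0)"

definition avg_fun :: "nat \<Rightarrow> (nat \<Rightarrow> 'a \<Rightarrow> real) \<Rightarrow> 'a \<Rightarrow> real" where
  "avg_fun n f x = (1 / real n) * (\<Sum>i=1..n. f i x)"

definition mat2 :: "real \<Rightarrow> real \<Rightarrow> real \<Rightarrow> real \<Rightarrow> real ^ 2 ^ 2" where
  "mat2 a b c d = vector [vector [a, b], vector [c, d]]"

definition mat3 ::
  "real \<Rightarrow> real \<Rightarrow> real \<Rightarrow> real \<Rightarrow> real \<Rightarrow> real \<Rightarrow> real \<Rightarrow> real \<Rightarrow> real \<Rightarrow> real ^ 3 ^ 3" where
  "mat3 a b c d e f g h k = vector [vector [a, b, c], vector [d, e, f], vector [g, h, k]]"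

definition block_embed :: "real ^ 2 ^ 2 \<Rightarrow> real ^ 3 ^ 3" where
  "block_embed X = mat3 (X $ 1 $ 1) (X $ 1 $ 2) 0
                        (X $ 2 $ 1) (X $ 2 $ 2) 0
                        0           0           0"

definition iid_uniform :: "'w measure \<Rightarrow> nat \<Rightarrow> (nat \<Rightarrow> 'w \<Rightarrow> nat) \<Rightarrow> bool" where
  "iid_uniform M n i \<longleftrightarrow> prob_space M \<and>
     prob_space.indep_vars M (\<lambda>_. count_space {1..n}) i UNIV \<and>
     (\<forall>t. distr M (count_space {1..n}) (i t) = uniform_count_measure {1..n})"

end

theory Submission
  imports Defs
begin

text \<open>Write \<open>\<xi> = x\<^sub>t - x\<^sub>t\<^sup>*\<close>, \<open>\<delta> = x\<^sub>t\<^sup>* - x\<^sub>t\<^sub>+\<^sub>1\<^sup>*\<close> and \<open>g\<close> for the sampled gradient at \<open>x\<^sub>t\<close>, so that the new error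
  is \<open>\<xi> - \<alpha> g + \<delta>\<close>. The matrix inequality, applied to \<open>(\<xi>, g, \<delta>)\<close>, bounds its squared norm by
  \<open>\<rho>\<^sup>2 \<parallel>\<xi>\<parallel>\<^sup>2 + \<lambda>\<^sub>2 \<parallel>\<delta>\<parallel>\<^sup>2\<close> minus \<open>\<lambda>\<^sub>1\<close> and \<open>\<lambda>\<^sub>3\<close> times two quadratic forms in \<open>(\<xi>, g)\<close>. Averaged over
  the sample, the first form is nonnegative because \<open>f\<^sub>t\<close> is strongly convex, and the second is at
  least \<open>- 2 G\<^sub>t\<^sup>2\<close> by smoothness, which enters through cocoercivity when the \<open>f\<^sub>t\<^sup>i\<close> are
  convex. Since the current sample is independent of \<open>x\<^sub>t\<close>, averaging over
  the index may be done inside the expectation.\<close>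

section \<open>Gradients in Euclidean space\<close>

text \<open>In finite dimension a derivative is a linear functional, represented by the vector
  \<open>g\<close> whose coordinates are its values on \<open>Basis\<close>. Uniqueness of
  derivatives makes the description in \<open>grad\<close> well defined.\<close>

lemma GDERIV_grad:
  fixes f :: "'a::euclidean_space \<Rightarrow> real"
  assumes "f differentiable (at x)"
  shows "GDERIV f x :> grad f x"
proof -
  obtain f' where f': "(f has_derivative f') (at x)"
    using assms by (auto simp: differentiable_def)
  define g where "g = (\<Sum>b\<in>Basis. f' b *\<^sub>R b)"
  have lin: "linear f'"
    using f' has_derivative_linear by blast
  have "f' h = h \<bullet> g" for h
  proof -
    have "f' h = f' (\<Sum>b\<in>Basis. (h \<bullet> b) *\<^sub>R b)"
      by (simp add: euclidean_representation)
    also have "\<dots> = (\<Sum>b\<in>Basis. (h \<bullet> b) * f' b)"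
      using lin by (simp add: linear_sum linear_cmul)
    also have "\<dots> = h \<bullet> g"
      by (simp add: g_def inner_sum_right mult.commute)
    finally show ?thesis .
  qed
  then have "f' = (\<lambda>h. h \<bullet> g)"
    by blast
  with f' have g: "GDERIV f x :> g"
    by (simp add: gderiv_def)
  have "g' = g" if "GDERIV f x :> g'" for g'
  proof -
    have "(\<lambda>h. h \<bullet> g') = (\<lambda>h. h \<bullet> g)"
      using has_derivative_unique that g unfolding gderiv_def by blast
    then have "\<forall>h. h \<bullet> g' = h \<bullet> g"
      by metis
    then show ?thesis
      by (simp add: vector_eq_ldot)
  qed
  then show ?thesis
    unfolding grad_def using g by (intro theI[where P = "\<lambda>g. GDERIV f x :> g"])
qed

lemma grad_eqI:
  fixes f :: "'a::euclidean_space \<Rightarrow> real"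
  assumes "GDERIV f x :> g"
  shows "grad f x = g"
proof -
  have "f differentiable (at x)"
    using assms by (auto simp: gderiv_def differentiable_def)
  then have "GDERIV f x :> grad f x"
    by (rule GDERIV_grad)
  then have "(\<lambda>h. h \<bullet> grad f x) = (\<lambda>h. h \<bullet> g)"
    using has_derivative_unique assms unfolding gderiv_def by blast
  then have "\<forall>h. h \<bullet> grad f x = h \<bullet> g"
    by metis
  then show ?thesis
    by (simp add: vector_eq_ldot)
qed

lemma grad_avg_fun:
  fixes f :: "nat \<Rightarrow> 'a::euclidean_space \<Rightarrow> real"
  assumes "\<And>i. i \<in> {1..n} \<Longrightarrow> f i differentiable (at x)"
  shows "grad (avg_fun n f) x = (1 / real n) *\<^sub>R (\<Sum>i=1..n. grad (f i) x)"
proof (rule grad_eqI)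
  have "((\<lambda>y. (1 / real n) * (\<Sum>i=1..n. f i y)) has_derivative
         (\<lambda>h. (1 / real n) * (\<Sum>i=1..n. h \<bullet> grad (f i) x))) (at x)"
    using assms GDERIV_grad unfolding gderiv_def
    by (intro has_derivative_mult_right has_derivative_sum) blast
  then show "GDERIV (avg_fun n f) x :> (1 / real n) *\<^sub>R (\<Sum>i=1..n. grad (f i) x)"
    by (simp add: gderiv_def avg_fun_def[abs_def] inner_sum_right)
qed

lemma grad_eq_zero_at_minimum:
  fixes f :: "'a::euclidean_space \<Rightarrow> real"
  assumes "f differentiable (at x)" and "\<And>y. f x \<le> f y"
  shows "grad f x = 0"
proof -
  have "(f has_derivative (\<lambda>h. h \<bullet> grad f x)) (at x)"
    using GDERIV_grad[OF assms(1)] by (simp add: gderiv_def)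
  then have "(\<lambda>h. h \<bullet> grad f x) = (\<lambda>h. 0)"
    by (rule has_derivative_local_min) (simp add: assms(2))
  then have "\<forall>h. h \<bullet> grad f x = h \<bullet> 0"
    by (metis inner_zero_right)
  then show ?thesis
    by (simp only: vector_eq_ldot)
qed

section \<open>Inequalities from smoothness and convexity\<close>

lemma DERIV_along_line:
  fixes f :: "'a::euclidean_space \<Rightarrow> real"
  assumes "f differentiable (at (x + s *\<^sub>R d))"
  shows "((\<lambda>s. f (x + s *\<^sub>R d)) has_real_derivative (grad f (x + s *\<^sub>R d) \<bullet> d)) (at s)"
proof -
  have "((\<lambda>s. x + s *\<^sub>R d) has_derivative (\<lambda>h. h *\<^sub>R d)) (at s)"
    by (auto intro!: derivative_eq_intros)
  from has_derivative_compose[OF this GDERIV_grad[OF assms, unfolded gderiv_def]]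
  show ?thesis
    by (simp add: has_field_derivative_def inner_commute mult_commute_abs)
qed

text \<open>The descent lemma, proved without integrals: \<open>\<phi>\<close> is \<open>f\<close>
  along the segment minus the claimed quadratic upper bound, up to a constant. By Cauchy-Schwarz and
  the Lipschitz gradient its derivative is nonpositive on \<open>[0, 1]\<close>.\<close>

lemma smooth_fun_upper_bound:
  fixes f :: "'a::euclidean_space \<Rightarrow> real"
  assumes "smooth_fun L f"
  shows "f y \<le> f x + grad f x \<bullet> (y - x) + L / 2 * (norm (y - x))\<^sup>2"
proof -
  define d where "d = y - x"
  define \<phi> where "\<phi> s = f (x + s *\<^sub>R d) - s * (grad f x \<bullet> d) - L * (norm d)\<^sup>2 * (s\<^sup>2 / 2)" for s
  have "\<phi> 0 \<ge> \<phi> 1"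
  proof (rule DERIV_nonpos_imp_nonincreasing[of 0 1 \<phi>])
    fix s :: real assume s: "0 \<le> s" "s \<le> 1"
    have diff: "f differentiable (at (x + s *\<^sub>R d))"
      using assms by (simp add: smooth_fun_def)
    have "DERIV \<phi> s :> grad f (x + s *\<^sub>R d) \<bullet> d - grad f x \<bullet> d - L * (norm d)\<^sup>2 * s"
      unfolding \<phi>_def by (auto intro!: derivative_eq_intros DERIV_along_line[OF diff])
    moreover have "grad f (x + s *\<^sub>R d) \<bullet> d - grad f x \<bullet> d - L * (norm d)\<^sup>2 * s \<le> 0"
    proof -
      have "grad f (x + s *\<^sub>R d) \<bullet> d - grad f x \<bullet> d \<le> norm (grad f (x + s *\<^sub>R d) - grad f x) * norm d"
        by (metis inner_diff_left norm_cauchy_schwarz)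
      also have "\<dots> \<le> (L * norm ((x + s *\<^sub>R d) - x)) * norm d"
        using assms unfolding smooth_fun_def by (intro mult_right_mono norm_ge_zero) blast
      also have "\<dots> = L * (norm d)\<^sup>2 * s"
        using s by (simp add: power2_eq_square)
      finally show ?thesis
        by simp
    qed
    ultimately show "\<exists>D. DERIV \<phi> s :> D \<and> D \<le> 0"
      by blast
  qed simp
  then show ?thesis
    by (simp add: \<phi>_def d_def)
qed

text \<open>Restricted to the line through \<open>y\<close> and \<open>x\<close>, a convex function
  lies above its tangent at \<open>y\<close>. This lets the convex case be treated as strong
  convexity with constant 0.\<close>

lemma convex_on_imp_strongly_convex_0:
  fixes f :: "'a::euclidean_space \<Rightarrow> real"
  assumes "convex_on UNIV f" and diff: "\<And>x. f differentiable (at x)"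
  shows "strongly_convex 0 f"
proof -
  have "f x \<ge> f y + grad f y \<bullet> (x - y)" for x y
  proof -
    define \<phi> where "\<phi> s = f (y + s *\<^sub>R (x - y))" for s
    have conv: "convex_on UNIV \<phi>"
    proof (rule convex_onI)
      fix u a b :: real assume "0 < u" "u < 1"
      have "y + ((1 - u) *\<^sub>R a + u *\<^sub>R b) *\<^sub>R (x - y)
          = (1 - u) *\<^sub>R (y + a *\<^sub>R (x - y)) + u *\<^sub>R (y + b *\<^sub>R (x - y))"
        by (simp add: algebra_simps)
      then show "\<phi> ((1 - u) *\<^sub>R a + u *\<^sub>R b) \<le> (1 - u) * \<phi> a + u * \<phi> b"
        unfolding \<phi>_def using convex_onD[OF assms(1), of u] \<open>0 < u\<close> \<open>u < 1\<close> by simp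
    qed simp
    have "(\<phi> has_real_derivative (grad f y \<bullet> (x - y))) (at 0)"
      using DERIV_along_line[of f y 0 "x - y"] diff by (simp add: \<phi>_def[abs_def])
    from convex_on_imp_above_tangent[OF conv, of 0 1, OF _ _ _ this]
    show ?thesis
      by (simp add: \<phi>_def)
  qed
  then show ?thesis
    using diff by (simp add: strongly_convex_def)
qed

text \<open>The case \<open>K = 0\<close> forces \<open>d = 0\<close>; choosing the step \<open>1 / K\<close> would miss it.\<close>

lemma norm_sq_le_of_quadratic_steps:
  fixes d :: "'a::real_inner"
  assumes "\<And>s. 2 * s * (norm d)\<^sup>2 - K * s\<^sup>2 * (norm d)\<^sup>2 \<le> c" and "K \<ge> 0"
  shows "(norm d)\<^sup>2 \<le> K * c"
proof (cases "K = 0")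
  case True
  have "(norm d)\<^sup>2 = 0"
  proof (rule ccontr)
    assume "(norm d)\<^sup>2 \<noteq> 0"
    \<comment> \<open>With \<open>K = 0\<close> this step length makes the left-hand side equal to
      \<open>c + 1\<close>, which exceeds \<open>c\<close>.\<close>
    then show False
      using assms(1)[of "(c + 1) / (2 * (norm d)\<^sup>2)"] True by simp
  qed
  then show ?thesis
    using True by simp
next
  case False
  \<comment> \<open>The step \<open>1 / K\<close> maximizes
    \<open>2 * s - K * s\<^sup>2\<close>.\<close>
  with assms(1)[of "1 / K"] assms(2) show ?thesis
    by (simp add: field_simps power2_eq_square)
qed

text \<open>The tangent at \<open>x\<close> bounds \<open>f\<close> from below (strong convexity) and the tangent at \<open>y\<close> bounds it
  from above (smoothness); the two are compared at \<open>y + s D\<close>, where \<open>D\<close> is the gradient difference of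
  \<open>f - m / 2 \<parallel>\<cdot>\<parallel>\<^sup>2\<close>.\<close>

lemma smooth_strongly_convex_cocoercive:
  fixes f :: "'a::euclidean_space \<Rightarrow> real"
  assumes sm: "smooth_fun L f" and sc: "strongly_convex m f" and "m \<le> L"
  shows "(norm (grad f x - grad f y))\<^sup>2 + L * m * (norm (x - y))\<^sup>2
         \<le> (L + m) * ((x - y) \<bullet> (grad f x - grad f y))"
proof -
  define D where "D x y = grad f x - grad f y - m *\<^sub>R (x - y)" for x y
  have half: "s * (norm (D x y))\<^sup>2 - (L - m) / 2 * s\<^sup>2 * (norm (D x y))\<^sup>2
      \<le> f y - f x - grad f x \<bullet> (y - x) - m / 2 * (norm (y - x))\<^sup>2" for s x y
  proof -
    let ?z = "y + s *\<^sub>R D x y"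
    have "f x + grad f x \<bullet> (?z - x) + m / 2 * (norm (?z - x))\<^sup>2
        \<le> f y + grad f y \<bullet> (?z - y) + L / 2 * (norm (?z - y))\<^sup>2"
      using sc[unfolded strongly_convex_def, THEN conjunct2, rule_format, of x ?z]
        smooth_fun_upper_bound[OF sm, of ?z y] by linarith
    moreover have "?z - x = (y - x) + s *\<^sub>R D x y"
      by simp
    moreover have "(norm ((y - x) + s *\<^sub>R D x y))\<^sup>2
        = (norm (y - x))\<^sup>2 + 2 * s * ((y - x) \<bullet> D x y) + s\<^sup>2 * (norm (D x y))\<^sup>2"
      unfolding power2_norm_eq_inner
      by (simp add: inner_add_left inner_add_right inner_commute algebra_simps power2_eq_square)
    moreover have norm_D: "(norm (D x y))\<^sup>2 = grad f x \<bullet> D x y - grad f y \<bullet> D x y + m * ((y - x) \<bullet> D x y)"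
      unfolding power2_norm_eq_inner
      by (subst (1) D_def) (simp add: inner_diff_left algebra_simps)
    ultimately have "f x + grad f x \<bullet> (y - x) + s * (grad f x \<bullet> D x y)
        + m / 2 * ((norm (y - x))\<^sup>2 + 2 * s * ((y - x) \<bullet> D x y) + s\<^sup>2 * (norm (D x y))\<^sup>2)
        \<le> f y + s * (grad f y \<bullet> D x y) + L / 2 * (s\<^sup>2 * (norm (D x y))\<^sup>2)"
      by (simp add: inner_add_right power_mult_distrib)
    moreover have "s * (norm (D x y))\<^sup>2
        = s * (grad f x \<bullet> D x y) - s * (grad f y \<bullet> D x y) + s * (m * ((y - x) \<bullet> D x y))"
      by (subst norm_D) (simp add: algebra_simps)
    ultimately show ?thesis
      by (simp add: field_simps)
  qed
  \<comment> \<open>Adding \<open>half\<close> for \<open>(x, y)\<close> and \<open>(y, x)\<close>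
    cancels the function values; \<open>D\<close> changes sign under the swap, so its norm is the
    same in both.\<close>
  have "2 * s * (norm (D x y))\<^sup>2 - (L - m) * s\<^sup>2 * (norm (D x y))\<^sup>2 \<le> (x - y) \<bullet> D x y" for s
  proof -
    have "D y x = - D x y"
      by (simp add: D_def algebra_simps)
    then have "2 * s * (norm (D x y))\<^sup>2 - (L - m) * s\<^sup>2 * (norm (D x y))\<^sup>2
      \<le> - (grad f x \<bullet> (y - x)) - grad f y \<bullet> (x - y) - m * (norm (x - y))\<^sup>2"
      using half[of s x y] half[of s y x] by (simp add: norm_minus_commute[of y x] field_simps)
    also have "\<dots> = (x - y) \<bullet> D x y"
      unfolding power2_norm_eq_inner
      by (simp add: D_def inner_diff_left inner_diff_right inner_commute algebra_simps)
    finally show ?thesis .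
  qed
  \<comment> \<open>This is cocoercivity of the gradient of
    \<open>f - m / 2 \<parallel>\<cdot>\<parallel>\<^sup>2\<close>, with constant
    \<open>L - m\<close>. That constant is 0 when \<open>m = L\<close>, hence the degenerate case of
    the step lemma. Expanding \<open>D\<close> gives the claim.\<close>
  then have "(norm (D x y))\<^sup>2 \<le> (L - m) * ((x - y) \<bullet> D x y)"
    using \<open>m \<le> L\<close> by (intro norm_sq_le_of_quadratic_steps) auto
  moreover have "(norm (D x y))\<^sup>2 = (norm (grad f x - grad f y))\<^sup>2
      - 2 * m * ((x - y) \<bullet> (grad f x - grad f y)) + m\<^sup>2 * (norm (x - y))\<^sup>2"
    unfolding D_def power2_norm_eq_inner
    by (simp add: inner_diff_left inner_diff_right inner_commute algebra_simps power2_eq_square)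
  moreover have "(x - y) \<bullet> D x y = (x - y) \<bullet> (grad f x - grad f y) - m * (norm (x - y))\<^sup>2"
    unfolding D_def power2_norm_eq_inner by (simp add: inner_diff_right)
  ultimately have "(norm (grad f x - grad f y))\<^sup>2
      - 2 * m * ((x - y) \<bullet> (grad f x - grad f y)) + m\<^sup>2 * (norm (x - y))\<^sup>2
      \<le> (L - m) * ((x - y) \<bullet> (grad f x - grad f y) - m * (norm (x - y))\<^sup>2)"
    by simp
  then show ?thesis
    by (simp add: left_diff_distrib right_diff_distrib distrib_right power2_eq_square[of m] mult.assoc
        mult.left_commute[of m L])
qed

text \<open>The gradient vanishes at \<open>z\<close>, so adding the strong convexity inequalities
  for \<open>(x, z)\<close> and \<open>(z, x)\<close> cancels the function values. Applied to the
  averaged objective, this controls the term with multiplier \<open>lam1\<close>.\<close>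

lemma strongly_convex_inner_minimizer:
  fixes f :: "'a::euclidean_space \<Rightarrow> real"
  assumes sc: "strongly_convex m f" and min: "\<And>y. f z \<le> f y"
  shows "m * (norm (x - z))\<^sup>2 \<le> (x - z) \<bullet> grad f x"
proof -
  have "grad f z = 0"
    using sc min by (intro grad_eq_zero_at_minimum) (auto simp: strongly_convex_def)
  then have "f x \<ge> f z + m / 2 * (norm (x - z))\<^sup>2"
    using sc unfolding strongly_convex_def by (metis add.right_neutral inner_zero_left)
  moreover have "f z \<ge> f x + grad f x \<bullet> (z - x) + m / 2 * (norm (z - x))\<^sup>2"
    using sc unfolding strongly_convex_def by blast
  ultimately show ?thesis
    by (simp add: norm_minus_commute[of z x] inner_diff_right inner_diff_left inner_commute)
qed

section \<open>Quadratic forms evaluated at vectors\<close>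

text \<open>The right-hand side minus the left is exactly the squared norm of
  \<open>a - 2 *\<^sub>R b\<close>.\<close>

lemma norm_sq_le_double_diff:
  fixes a b :: "'a::real_inner"
  shows "(norm a)\<^sup>2 \<le> 2 * (norm (a - b))\<^sup>2 + 2 * (norm b)\<^sup>2"
proof -
  have "0 \<le> (norm (a - 2 *\<^sub>R b))\<^sup>2"
    by simp
  then show ?thesis
    unfolding power2_norm_eq_inner
    by (simp add: inner_diff_left inner_diff_right inner_commute algebra_simps)
qed

text \<open>The left-hand side is the sum over the coordinates \<open>k\<close> of the quadratic forms of \<open>B\<close> at
  \<open>(u\<^sub>k, v\<^sub>k, w\<^sub>k)\<close>.\<close>

lemma neg_semidef_mat3_vectors:
  fixes B :: "real ^ 3 ^ 3" and u v w :: "real ^ 'p"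
  assumes "neg_semidef B"
  shows "B $ 1 $ 1 * (norm u)\<^sup>2 + B $ 2 $ 2 * (norm v)\<^sup>2 + B $ 3 $ 3 * (norm w)\<^sup>2
       + 2 * (B $ 1 $ 2) * (u \<bullet> v) + 2 * (B $ 1 $ 3) * (u \<bullet> w) + 2 * (B $ 2 $ 3) * (v \<bullet> w) \<le> 0"
proof -
  have sym: "B $ 2 $ 1 = B $ 1 $ 2" "B $ 3 $ 1 = B $ 1 $ 3" "B $ 3 $ 2 = B $ 2 $ 3"
    using assms unfolding neg_semidef_def transpose_def by (metis vec_lambda_beta)+
  have "B $ 1 $ 1 * (u $ k * u $ k) + B $ 2 $ 2 * (v $ k * v $ k) + B $ 3 $ 3 * (w $ k * w $ k)
       + 2 * (B $ 1 $ 2) * (u $ k * v $ k) + 2 * (B $ 1 $ 3) * (u $ k * w $ k)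
       + 2 * (B $ 2 $ 3) * (v $ k * w $ k) \<le> 0" for k
  proof -
    let ?q = "vector [u $ k, v $ k, w $ k] :: real ^ 3"
    have "?q \<bullet> (B *v ?q) \<le> 0"
      using assms by (simp add: neg_semidef_def)
    then show ?thesis
      by (simp add: inner_vec_def matrix_vector_mult_def sum_3 sym algebra_simps)
  qed
  then have "(\<Sum>k\<in>UNIV. B $ 1 $ 1 * (u $ k * u $ k) + B $ 2 $ 2 * (v $ k * v $ k) + B $ 3 $ 3 * (w $ k * w $ k)
       + 2 * (B $ 1 $ 2) * (u $ k * v $ k) + 2 * (B $ 1 $ 3) * (u $ k * w $ k)
       + 2 * (B $ 2 $ 3) * (v $ k * w $ k)) \<le> 0"
    by (intro sum_nonpos) auto
  then show ?thesis
    unfolding power2_norm_eq_inner by (simp add: inner_vec_def sum.distrib sum_distrib_left)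
qed

section \<open>Random iterates and averaging over the current sample\<close>

text \<open>The iteration driven by a fixed index sequence \<open>j\<close>. It separates the
  deterministic recursion from the randomness, so that an iterate can be written as a function of
  the past samples alone.\<close>

primrec iterate_samples :: "(nat \<Rightarrow> nat \<Rightarrow> 'a \<Rightarrow> 'a) \<Rightarrow> 'a \<Rightarrow> (nat \<Rightarrow> nat) \<Rightarrow> nat \<Rightarrow> 'a" where
  "iterate_samples step x0 j 0 = x0"
| "iterate_samples step x0 j (Suc t) = step t (j t) (iterate_samples step x0 j t)"

lemma iterate_samples_cong:
  "(\<And>s. s < t \<Longrightarrow> j s = j' s) \<Longrightarrow> iterate_samples step x0 j t = iterate_samples step x0 j' t"
  by (induction t) auto

lemma iid_uniform_prob:
  assumes "iid_uniform M n idx" and "i \<in> {1..n}"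
  shows "measure M {\<omega> \<in> space M. idx t \<omega> = i} = 1 / real n"
proof -
  interpret prob_space M
    using assms by (simp add: iid_uniform_def)
  have meas: "idx t \<in> M \<rightarrow>\<^sub>M count_space {1..n}"
    using assms unfolding iid_uniform_def indep_vars_def by simp
  have "measure M {\<omega> \<in> space M. idx t \<omega> = i} = measure (distr M (count_space {1..n}) (idx t)) {i}"
    using meas assms(2) by (subst measure_distr) (auto intro!: arg_cong[where f = "measure M"])
  also have "\<dots> = 1 / real n"
    using assms by (simp add: iid_uniform_def measure_uniform_count_measure)
  finally show ?thesis .
qed

text \<open>The iterate at time \<open>t\<close> is a function of the tuple of samples before \<open>t\<close>. That tuple takes only
  finitely many values, so every function of the iterate is measurable and bounded.\<close>

lemma
  fixes x :: "nat \<Rightarrow> 'w \<Rightarrow> 'a" and step :: "nat \<Rightarrow> nat \<Rightarrow> 'a \<Rightarrow> 'a"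
  assumes iid: "iid_uniform M n idx"
    and x0: "\<And>\<omega>. \<omega> \<in> space M \<Longrightarrow> x 0 \<omega> = x0"
    and xSuc: "\<And>t \<omega>. \<omega> \<in> space M \<Longrightarrow> x (Suc t) \<omega> = step t (idx t \<omega>) (x t \<omega>)"
  shows integrable_iterate: "integrable M (\<lambda>\<omega>. \<phi> (x t \<omega>) :: real)"
    and integrable_iterate_sample: "integrable M (\<lambda>\<omega>. \<psi> (x t \<omega>) (idx t \<omega>) :: real)"
    and expectation_iterate_sample: "(\<integral>\<omega>. \<psi> (x t \<omega>) (idx t \<omega>) \<partial>M)
      = (\<integral>\<omega>. (1 / real n) * (\<Sum>i=1..n. \<psi> (x t \<omega>) i) \<partial>M)"
proof -
  interpret prob_space M
    using iid by (simp add: iid_uniform_def)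
  let ?C = "\<lambda>_::nat. count_space {1..n}"
  define S where "S = PiE {..<t} (\<lambda>_. {1..n})"
  define Y where "Y \<omega> = restrict (\<lambda>s. idx s \<omega>) {..<t}" for \<omega>
  define F where "F j = iterate_samples step x0 j t" for j
  have fin: "finite S"
    unfolding S_def by (intro finite_PiE) auto
  have PiM_past: "PiM {..<t} ?C = count_space S"
    unfolding S_def by (rule count_space_PiM_finite) auto
  \<comment> \<open>Past and current samples use the disjoint index blocks \<open>{..<t}\<close> and
    \<open>{t}\<close>, so grouping the independent family makes the two tuples independent.\<close>
  have indep: "indep_var (count_space S) Y (PiM {t} ?C) (\<lambda>\<omega>. restrict (\<lambda>s. idx s \<omega>) {t})"
    using indep_var_restrict[of ?C idx UNIV "{..<t}" "{t}"] iid
    unfolding iid_uniform_def PiM_past Y_def[abs_def] by auto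
  have Y: "Y \<in> M \<rightarrow>\<^sub>M count_space S"
    using indep by (rule indep_var_rv1)
  have idx: "idx t \<in> M \<rightarrow>\<^sub>M count_space {1..n}"
    using iid unfolding iid_uniform_def indep_vars_def by simp
  have x: "x t \<omega> = F (Y \<omega>)" if "\<omega> \<in> space M" for \<omega>
  proof -
    have "x t \<omega> = iterate_samples step x0 (\<lambda>s. idx s \<omega>) t"
      using that by (induction t) (auto simp: x0 xSuc)
    also have "\<dots> = F (Y \<omega>)"
      unfolding F_def by (rule iterate_samples_cong) (simp add: Y_def)
    finally show ?thesis .
  qed
  have integrable_past: "integrable M (\<lambda>\<omega>. h (Y \<omega>) :: real)" for h
  proof (rule integrable_const_bound)
    show "AE \<omega> in M. norm (h (Y \<omega>)) \<le> Max ((\<lambda>y. norm (h y)) ` S)"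
      using measurable_space[OF Y] fin by (intro AE_I2) (auto intro!: Max_ge)
    show "(\<lambda>\<omega>. h (Y \<omega>)) \<in> borel_measurable M"
      by (rule measurable_compose[OF Y]) simp
  qed
  show "integrable M (\<lambda>\<omega>. \<phi> (x t \<omega>) :: real)"
    using integrable_past[of "\<phi> \<circ> F"] x by (simp cong: Bochner_Integration.integrable_cong)
  let ?ind = "\<lambda>i \<omega>. indicat_real {i} (idx t \<omega>)"
  have ind: "?ind i \<in> borel_measurable M" for i
    by (rule measurable_compose[OF idx]) simp
  have int_ind: "integrable M (?ind i)" for i
    by (rule integrable_const_bound[where B = 1]) (use ind in \<open>auto simp: indicator_le_1\<close>)
  have exp_ind: "(\<integral>\<omega>. ?ind i \<omega> \<partial>M) = 1 / real n" if "i \<in> {1..n}" for i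
  proof -
    have "{\<omega> \<in> space M. idx t \<omega> = i} \<in> sets M"
      using measurable_sets[OF idx, of "{i}"] that by (simp add: vimage_def Int_def conj_commute)
    moreover have "(\<integral>\<omega>. ?ind i \<omega> \<partial>M) = (\<integral>\<omega>. indicat_real {\<omega> \<in> space M. idx t \<omega> = i} \<omega> \<partial>M)"
      by (rule Bochner_Integration.integral_cong) (auto simp: indicator_def)
    ultimately show ?thesis
      using iid_uniform_prob[OF iid that] by simp
  qed
  have indep_real: "indep_var borel (\<lambda>\<omega>. \<psi> (F (Y \<omega>)) i) borel (?ind i)" for i
  proof -
    have "(\<lambda>j. indicat_real {i} (j t)) \<in> borel_measurable (PiM {t} ?C)"
      by (rule measurable_compose[OF measurable_component_singleton]) auto
    then show ?thesis
      using indep_var_compose[OF indep, of "\<lambda>y. \<psi> (F y) i" borel "\<lambda>j. indicat_real {i} (j t)" borel]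
      by (simp add: o_def)
  qed
  \<comment> \<open>Splitting by the value of the current sample gives products of a function of the
    past and an indicator of the present. Independence factorizes the expectation of each
    product.\<close>
  have split: "\<psi> (x t \<omega>) (idx t \<omega>) = (\<Sum>i=1..n. \<psi> (F (Y \<omega>)) i * ?ind i \<omega>)" if "\<omega> \<in> space M" for \<omega>
    using measurable_space[OF idx that] that
    by (simp add: x indicator_def if_distrib sum.delta cong: if_cong)
  have int_prod: "integrable M (\<lambda>\<omega>. \<psi> (F (Y \<omega>)) i * ?ind i \<omega>)" for i
    by (rule indep_var_integrable[OF indep_real integrable_past int_ind])
  show "integrable M (\<lambda>\<omega>. \<psi> (x t \<omega>) (idx t \<omega>) :: real)"
    by (subst Bochner_Integration.integrable_cong[OF refl split])
      (auto intro: Bochner_Integration.integrable_sum int_prod simp del: sum_mult_indicator)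
  have "(\<integral>\<omega>. \<psi> (x t \<omega>) (idx t \<omega>) \<partial>M) = (\<integral>\<omega>. (\<Sum>i=1..n. \<psi> (F (Y \<omega>)) i * ?ind i \<omega>) \<partial>M)"
    using split by (intro Bochner_Integration.integral_cong) simp_all
  also have "\<dots> = (\<Sum>i=1..n. \<integral>\<omega>. \<psi> (F (Y \<omega>)) i * ?ind i \<omega> \<partial>M)"
    using int_prod by (rule Bochner_Integration.integral_sum)
  also have "\<dots> = (\<Sum>i=1..n. (\<integral>\<omega>. \<psi> (F (Y \<omega>)) i \<partial>M) * (1 / real n))"
    using exp_ind
    by (intro sum.cong) (simp_all add: indep_var_lebesgue_integral[OF indep_real integrable_past int_ind])
  also have "\<dots> = (1 / real n) * (\<integral>\<omega>. (\<Sum>i=1..n. \<psi> (F (Y \<omega>)) i) \<partial>M)"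
    by (subst Bochner_Integration.integral_sum) (rule integrable_past, simp add: sum_divide_distrib)
  also have "\<dots> = (\<integral>\<omega>. (1 / real n) * (\<Sum>i=1..n. \<psi> (F (Y \<omega>)) i) \<partial>M)"
    by simp
  also have "\<dots> = (\<integral>\<omega>. (1 / real n) * (\<Sum>i=1..n. \<psi> (x t \<omega>) i) \<partial>M)"
    using x by (simp cong: Bochner_Integration.integral_cong)
  finally show "(\<integral>\<omega>. \<psi> (x t \<omega>) (idx t \<omega>) \<partial>M)
      = (\<integral>\<omega>. (1 / real n) * (\<Sum>i=1..n. \<psi> (x t \<omega>) i) \<partial>M)" .
qed

section \<open>Lower bounds for the gradient quadratic forms\<close>

text \<open>Splitting off the gradient at the minimizer makes the linear term \<open>(x - z) \<bullet> grad (f i) z\<close>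
  vanish after averaging over \<open>i\<close>.\<close>

lemma average_quadratic_lower_bound:
  fixes f :: "nat \<Rightarrow> 'a::euclidean_space \<Rightarrow> real"
  assumes "n \<ge> 1"
    and diff: "\<And>i y. i \<in> {1..n} \<Longrightarrow> f i differentiable (at y)"
    and min: "\<And>y. avg_fun n f z \<le> avg_fun n f y"
    and bound: "\<And>i. i \<in> {1..n} \<Longrightarrow>
      - 2 * (norm (grad (f i) z))\<^sup>2 \<le> a * (norm (x - z))\<^sup>2
        + 2 * b * ((x - z) \<bullet> (grad (f i) x - grad (f i) z)) + c * (norm (grad (f i) x))\<^sup>2"
  shows "- 2 * (\<Sum>i=1..n. (norm (grad (f i) z))\<^sup>2) \<le>
    (\<Sum>i=1..n. a * (norm (x - z))\<^sup>2 + 2 * b * ((x - z) \<bullet> grad (f i) x) + c * (norm (grad (f i) x))\<^sup>2)"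
proof -
  have "avg_fun n f differentiable (at z)"
    unfolding avg_fun_def[abs_def] using diff \<open>n \<ge> 1\<close> by (auto intro!: derivative_intros)
  then have "grad (avg_fun n f) z = 0"
    using min by (rule grad_eq_zero_at_minimum)
  then have "(\<Sum>i=1..n. grad (f i) z) = 0"
    using grad_avg_fun[of n f z] diff \<open>n \<ge> 1\<close> by force
  then have zero: "(\<Sum>i=1..n. (x - z) \<bullet> grad (f i) z) = 0"
    by (metis inner_sum_right inner_zero_right)
  have "- 2 * (\<Sum>i=1..n. (norm (grad (f i) z))\<^sup>2) = (\<Sum>i=1..n. - 2 * (norm (grad (f i) z))\<^sup>2)"
    by (simp add: sum_distrib_left sum_negf)
  also have "\<dots> \<le> (\<Sum>i=1..n. (a * (norm (x - z))\<^sup>2 + 2 * b * ((x - z) \<bullet> grad (f i) x)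
      + c * (norm (grad (f i) x))\<^sup>2) - 2 * b * ((x - z) \<bullet> grad (f i) z))"
    using bound by (intro sum_mono) (simp add: inner_diff_right algebra_simps)
  also have "\<dots> = (\<Sum>i=1..n. a * (norm (x - z))\<^sup>2 + 2 * b * ((x - z) \<bullet> grad (f i) x)
      + c * (norm (grad (f i) x))\<^sup>2) - 2 * b * (\<Sum>i=1..n. (x - z) \<bullet> grad (f i) z)"
    by (simp only: sum_subtractf sum_distrib_left)
  finally show ?thesis
    using zero by simp
qed

lemma smooth_gradient_bound:
  fixes f :: "'a::euclidean_space \<Rightarrow> real"
  assumes "smooth_fun L f"
  shows "(norm (grad f x))\<^sup>2 \<le> 2 * L\<^sup>2 * (norm (x - z))\<^sup>2 + 2 * (norm (grad f z))\<^sup>2"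
proof -
  have "norm (grad f x - grad f z) \<le> L * norm (x - z)"
    using assms by (simp add: smooth_fun_def)
  then have "(norm (grad f x - grad f z))\<^sup>2 \<le> (L * norm (x - z))\<^sup>2"
    by (rule power_mono) simp
  then show ?thesis
    using norm_sq_le_double_diff[of "grad f x" "grad f z"] by (simp add: power_mult_distrib)
qed

text \<open>Cocoercivity bounds the gradient difference; passing to the gradient at \<open>x\<close>
  doubles that bound and costs twice the squared gradient at \<open>z\<close>. The instance
  \<open>m = 0\<close> serves the convex case.\<close>

lemma smooth_strongly_convex_gradient_bound:
  fixes f :: "'a::euclidean_space \<Rightarrow> real"
  assumes "smooth_fun L f" and "strongly_convex m f" and "m \<le> L"
  shows "(norm (grad f x))\<^sup>2 \<le> - 2 * L * m * (norm (x - z))\<^sup>2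
    + 2 * (L + m) * ((x - z) \<bullet> (grad f x - grad f z)) + 2 * (norm (grad f z))\<^sup>2"
  using smooth_strongly_convex_cocoercive[OF assms, of x z]
    norm_sq_le_double_diff[of "grad f x" "grad f z"]
  by (simp only: mult.assoc)

section \<open>The one-step bound on the expected squared error\<close>

theorem lemma4p3:
  fixes n :: nat
    and M :: "'w measure" and idx :: "nat \<Rightarrow> 'w \<Rightarrow> nat"
    and f :: "nat \<Rightarrow> nat \<Rightarrow> real ^ 'p \<Rightarrow> real"
    and m L \<sigma> \<alpha> G :: "nat \<Rightarrow> real"
    and x0 :: "real ^ 'p"
    and x :: "nat \<Rightarrow> 'w \<Rightarrow> real ^ 'p"
    and xstar :: "nat \<Rightarrow> real ^ 'p"
    and X :: "nat \<Rightarrow> real ^ 2 ^ 2"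
    and t :: nat and \<rho> lam1 lam2 lam3 :: real
  assumes "n \<ge> 1"
    and "\<forall>t. 0 < m t \<and> m t \<le> L t"
    and "\<forall>t. \<sigma> t \<ge> 0"
    and "\<forall>t. \<alpha> t \<ge> 0"
    and "\<forall>t. \<forall>i\<in>{1..n}. \<forall>y. f t i differentiable (at y)"
    and "iid_uniform M n idx"
    and "\<forall>\<omega>\<in>space M. x 0 \<omega> = x0"
    and "\<forall>t. \<forall>\<omega>\<in>space M. x (Suc t) \<omega> = x t \<omega> - \<alpha> t *\<^sub>R grad (f t (idx t \<omega>)) (x t \<omega>)"
    and "\<forall>t. strongly_convex (m t) (avg_fun n (f t))"
    and "\<forall>t y. avg_fun n (f t) (xstar t) \<le> avg_fun n (f t) y"
    and "\<forall>t. norm (xstar (Suc t) - xstar t) \<le> \<sigma> t"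
    and "\<forall>t. G t \<ge> 0 \<and> (G t)\<^sup>2 = (1 / real n) * (\<Sum>i=1..n. (norm (grad (f t i) (xstar t)))\<^sup>2)"
    and "((\<forall>t. \<forall>i\<in>{1..n}. smooth_fun (L t) (f t i)) \<and>
          (\<forall>t. X t = mat2 (2 * (L t)\<^sup>2) 0
                          0            (- 1)))
       \<or> ((\<forall>t. \<forall>i\<in>{1..n}. smooth_fun (L t) (f t i) \<and> convex_on UNIV (f t i)) \<and>
          (\<forall>t. X t = mat2 0     (L t)
                          (L t) (- 1)))
       \<or> ((\<forall>t. \<forall>i\<in>{1..n}. smooth_fun (L t) (f t i) \<and> strongly_convex (m t) (f t i)) \<and>
          (\<forall>t. X t = mat2 (- 2 * L t * m t) (L t + m t)
                          (L t + m t)       (- 1)))"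
    and "\<rho> \<ge> 0" and "lam1 \<ge> 0" and "lam2 \<ge> 0" and "lam3 \<ge> 0"
    and "neg_semidef
           (mat3 (1 - \<rho>\<^sup>2) (- \<alpha> t)   1
                 (- \<alpha> t)   ((\<alpha> t)\<^sup>2)  (- \<alpha> t)
                 1         (- \<alpha> t)   (1 - lam2)
          + lam1 *\<^sub>R mat3 (- 2 * m t) 1 0
                         1           0 0
                         0           0 0
          + lam3 *\<^sub>R block_embed (X t))"
  shows "prob_space.expectation M (\<lambda>\<omega>. (norm (x (Suc t) \<omega> - xstar (Suc t)))\<^sup>2)
         \<le> \<rho>\<^sup>2 * prob_space.expectation M (\<lambda>\<omega>. (norm (x t \<omega> - xstar t))\<^sup>2)
           + lam2 * (\<sigma> t)\<^sup>2 + 2 * lam3 * (G t)\<^sup>2"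
proof -
  note n = assms(1) and mL = assms(2) and diff = assms(5) and iid = assms(6) and x0 = assms(7)
    and xSuc = assms(8) and sc = assms(9) and min = assms(10) and drift = assms(11) and G = assms(12)
    and cases = assms(13) and nonneg = assms(15-17) and lmi = assms(18)
  interpret prob_space M
    using iid by (simp add: iid_uniform_def)
  define z \<delta> where "z = xstar t" and "\<delta> = xstar t - xstar (Suc t)"
  define g where "g i y = grad (f t i) y" for i y
  define \<psi> where "\<psi> y i = (norm (y - \<alpha> t *\<^sub>R g i y - xstar (Suc t)))\<^sup>2" for y i
  \<comment> \<open>The quadratic form of \<open>X t\<close> at \<open>(y - z, g i y)\<close>; the
    factor 2 reflects the symmetry of \<open>X t\<close>.\<close>
  define q where "q y i = X t $ 1 $ 1 * (norm (y - z))\<^sup>2 + 2 * (X t $ 1 $ 2) * ((y - z) \<bullet> g i y)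
    + X t $ 2 $ 2 * (norm (g i y))\<^sup>2" for y i
  \<comment> \<open>The mixed term contains a gradient difference where \<open>q\<close> has the
    gradient itself; the two agree only after averaging over \<open>i\<close>.\<close>
  have entry_bound: "- 2 * (norm (g i z))\<^sup>2 \<le> X t $ 1 $ 1 * (norm (y - z))\<^sup>2
      + 2 * (X t $ 1 $ 2) * ((y - z) \<bullet> (g i y - g i z)) + X t $ 2 $ 2 * (norm (g i y))\<^sup>2"
    if i: "i \<in> {1..n}" for i y
    using cases
  proof (elim disjE conjE)
    assume "\<forall>t. \<forall>i\<in>{1..n}. smooth_fun (L t) (f t i)" and X: "\<forall>t. X t = mat2 (2 * (L t)\<^sup>2) 0 0 (- 1)"
    then show ?thesis
      using smooth_gradient_bound[of "L t" "f t i" y z] i by (simp add: X mat2_def g_def)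
  next
    assume f: "\<forall>t. \<forall>i\<in>{1..n}. smooth_fun (L t) (f t i) \<and> convex_on UNIV (f t i)"
      and X: "\<forall>t. X t = mat2 0 (L t) (L t) (- 1)"
    \<comment> \<open>Putting 0 for \<open>m t\<close> in the matrix of the strongly convex case
      gives the matrix of this case.\<close>
    then have "strongly_convex 0 (f t i)"
      using i diff by (intro convex_on_imp_strongly_convex_0) auto
    moreover have "0 \<le> L t"
      using mL by (meson less_le_trans less_imp_le)
    ultimately show ?thesis
      using smooth_strongly_convex_gradient_bound[of "L t" "f t i" 0 y z] i f
      by (simp add: X mat2_def g_def)
  next
    assume "\<forall>t. \<forall>i\<in>{1..n}. smooth_fun (L t) (f t i) \<and> strongly_convex (m t) (f t i)"
      and X: "\<forall>t. X t = mat2 (- 2 * L t * m t) (L t + m t) (L t + m t) (- 1)"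
    then show ?thesis
      using smooth_strongly_convex_gradient_bound[of "L t" "f t i" "m t" y z] i mL
      by (simp add: X mat2_def g_def)
  qed
  have avg_q: "- 2 * (G t)\<^sup>2 \<le> (1 / real n) * (\<Sum>i=1..n. q y i)" for y
  proof -
    have "- 2 * (\<Sum>i=1..n. (norm (g i z))\<^sup>2) \<le> (\<Sum>i=1..n. q y i)"
      unfolding q_def g_def
      by (rule average_quadratic_lower_bound) (use n diff min entry_bound in \<open>auto simp: g_def z_def\<close>)
    then have "(1 / real n) * (- 2 * (\<Sum>i=1..n. (norm (g i z))\<^sup>2)) \<le> (1 / real n) * (\<Sum>i=1..n. q y i)"
      by (intro mult_left_mono) auto
    then show ?thesis
      using G by (simp add: g_def z_def)
  qed
  have avg_inner: "m t * (norm (y - z))\<^sup>2 \<le> (1 / real n) * (\<Sum>i=1..n. (y - z) \<bullet> g i y)" for y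
  proof -
    have "m t * (norm (y - z))\<^sup>2 \<le> (y - z) \<bullet> grad (avg_fun n (f t)) y"
      using sc min by (intro strongly_convex_inner_minimizer) (auto simp: z_def)
    then show ?thesis
      using grad_avg_fun[of n "f t" y] diff by (simp add: inner_sum_right g_def)
  qed
  \<comment> \<open>The first matrix of the inequality is the outer product of
    \<open>(1, - \<alpha> t, 1)\<close> with itself, minus the diagonal matrix with entries
    \<open>\<rho>\<^sup>2\<close>, 0, \<open>lam2\<close>. The outer product yields the squared norm
    of the new error.\<close>
  have pointwise: "\<psi> y i \<le> \<rho>\<^sup>2 * (norm (y - z))\<^sup>2 + lam2 * (norm \<delta>)\<^sup>2
      - 2 * lam1 * ((y - z) \<bullet> g i y - m t * (norm (y - z))\<^sup>2) - lam3 * q y i" for y i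
  proof -
    have "y - \<alpha> t *\<^sub>R g i y - xstar (Suc t) = (y - z) - \<alpha> t *\<^sub>R g i y + \<delta>"
      by (simp add: z_def \<delta>_def)
    then have "\<psi> y i = (norm (y - z))\<^sup>2 + (\<alpha> t)\<^sup>2 * (norm (g i y))\<^sup>2 + (norm \<delta>)\<^sup>2
        - 2 * \<alpha> t * ((y - z) \<bullet> g i y) + 2 * ((y - z) \<bullet> \<delta>) - 2 * \<alpha> t * (g i y \<bullet> \<delta>)"
      unfolding \<psi>_def power2_norm_eq_inner
      by (simp only: inner_add_left inner_add_right inner_diff_left inner_diff_right)
        (simp add: inner_commute algebra_simps power2_eq_square)
    then show ?thesis
      using neg_semidef_mat3_vectors[OF lmi, of "y - z" "g i y" \<delta>]
      by (simp add: mat3_def block_embed_def q_def algebra_simps)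
  qed
  have avg: "(1 / real n) * (\<Sum>i=1..n. \<psi> y i)
      \<le> \<rho>\<^sup>2 * (norm (y - z))\<^sup>2 + (lam2 * (\<sigma> t)\<^sup>2 + 2 * lam3 * (G t)\<^sup>2)" for y
  proof -
    let ?c = "\<rho>\<^sup>2 * (norm (y - z))\<^sup>2 + lam2 * (norm \<delta>)\<^sup>2 + 2 * lam1 * m t * (norm (y - z))\<^sup>2"
    have "(1 / real n) * (\<Sum>i=1..n. \<psi> y i)
        \<le> (1 / real n) * (\<Sum>i=1..n. ?c - 2 * lam1 * ((y - z) \<bullet> g i y) - lam3 * q y i)"
      using pointwise[of y] by (intro mult_left_mono sum_mono) (simp_all add: algebra_simps)
    also have "\<dots> = (1 / real n) * (real n * ?c - 2 * lam1 * (\<Sum>i=1..n. (y - z) \<bullet> g i y)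
        - lam3 * (\<Sum>i=1..n. q y i))"
      by (simp only: sum_subtractf sum_distrib_left sum_constant card_atLeastAtMost) simp
    also have "\<dots> = ?c - 2 * lam1 * ((1 / real n) * (\<Sum>i=1..n. (y - z) \<bullet> g i y))
        - lam3 * ((1 / real n) * (\<Sum>i=1..n. q y i))"
      using n by (simp add: field_simps)
    finally have *: "(1 / real n) * (\<Sum>i=1..n. \<psi> y i) \<le> \<dots>" .
    \<comment> \<open>Nonnegativity of the three multipliers preserves the direction of the drift
      bound, of \<open>avg_inner\<close> and of \<open>avg_q\<close>. The \<open>lam1\<close>
      contributions then total at most 0.\<close>
    have "norm \<delta> \<le> \<sigma> t"
      using drift by (simp add: \<delta>_def norm_minus_commute)
    then have "lam2 * (norm \<delta>)\<^sup>2 \<le> lam2 * (\<sigma> t)\<^sup>2"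
      using nonneg by (intro mult_left_mono power_mono) auto
    moreover have "2 * lam1 * (m t * (norm (y - z))\<^sup>2)
        \<le> 2 * lam1 * ((1 / real n) * (\<Sum>i=1..n. (y - z) \<bullet> g i y))"
      using avg_inner nonneg by (intro mult_left_mono) auto
    moreover have "lam3 * (- 2 * (G t)\<^sup>2) \<le> lam3 * ((1 / real n) * (\<Sum>i=1..n. q y i))"
      using avg_q nonneg by (intro mult_left_mono) auto
    ultimately show ?thesis
      using * by (simp only: mult.assoc)
  qed
  have x0': "x 0 \<omega> = x0" if "\<omega> \<in> space M" for \<omega>
    using x0 that by blast
  have step: "x (Suc t) \<omega> = x t \<omega> - \<alpha> t *\<^sub>R grad (f t (idx t \<omega>)) (x t \<omega>)" if "\<omega> \<in> space M" for t \<omega>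
    using xSuc that by blast
  let ?step = "\<lambda>t i y. y - \<alpha> t *\<^sub>R grad (f t i) y"
  note int = integrable_iterate[where step = ?step and x = x and n = n, OF iid x0' step]
    and exp = expectation_iterate_sample[where step = ?step and x = x and n = n, OF iid x0' step]
  have "expectation (\<lambda>\<omega>. (norm (x (Suc t) \<omega> - xstar (Suc t)))\<^sup>2) = expectation (\<lambda>\<omega>. \<psi> (x t \<omega>) (idx t \<omega>))"
    using step by (simp add: \<psi>_def g_def cong: Bochner_Integration.integral_cong)
  also have "\<dots> = expectation (\<lambda>\<omega>. (1 / real n) * (\<Sum>i=1..n. \<psi> (x t \<omega>) i))"
    by (rule exp)
  \<comment> \<open>The bound \<open>avg\<close> holds at every fixed point \<open>y\<close>, so it
    applies to the random iterate outcome by outcome.\<close>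
  also have "\<dots> \<le> expectation (\<lambda>\<omega>. \<rho>\<^sup>2 * (norm (x t \<omega> - z))\<^sup>2 + (lam2 * (\<sigma> t)\<^sup>2 + 2 * lam3 * (G t)\<^sup>2))"
    by (intro integral_mono avg int)
  also have "\<dots> = \<rho>\<^sup>2 * expectation (\<lambda>\<omega>. (norm (x t \<omega> - z))\<^sup>2) + (lam2 * (\<sigma> t)\<^sup>2 + 2 * lam3 * (G t)\<^sup>2)"
    using int[of "\<lambda>y. (norm (y - z))\<^sup>2"] by (simp add: prob_space)
  finally show ?thesis
    by (simp add: z_def)
qed

end
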